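(* Let $G$ be a simple graph with vertex set $V=\{v_1,\dots,v_n\}$ and maximum degree $\Delta$. Let $G^\sigma$ be an oriented graph of $G$ with skew adjacency matrix $S=(S_1,\dots,S_n)$, where $S_k$ denotes the $k$-th column of $S$. If there exists a vertex $v_k$ with $d_G(v_k)=\Delta$ such that $S_k^TS_j=0$ for every $j\neq k$, then $\mathrm{i}\sqrt{\Delta}$ (with $\mathrm{i}$ the imaginary unit) is an eigenvalue of $S$.
   Context: An oriented graph $G^\sigma$ of a simple graph $G$ on vertices $v_1,\dots,v_n$ is obtained by giving each edge of $G$ one of its two directions. Its skew adjacency matrix $S=(s_{ij})$ has $s_{ij}=1$, $s_{ji}=-1$ if $\langle v_i,v_j\rangle$ is an arc, and $s_{ij}=s_{ji}=0$ otherwise. The eigenvalues of $G^\sigma$ are those of $S$. $d_G(v)$ denotes the degree of $v$ in $G$. *)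

theory Defs
  imports Complex_Main "Jordan_Normal_Form.Char_Poly"
begin

definition simple_graph :: "'a set \<Rightarrow> 'a set set \<Rightarrow> bool" where
  "simple_graph V E \<longleftrightarrow> finite V \<and> (\<forall>e\<in>E. e \<subseteq> V \<and> card e = 2)"

definition vertex_degree :: "'a set set \<Rightarrow> 'a \<Rightarrow> nat" where
  "vertex_degree E v = card {e \<in> E. v \<in> e}"

(* Only meaningful for a nonempty finite vertex set. *)
definition max_degree :: "'a set \<Rightarrow> 'a set set \<Rightarrow> nat" where
  "max_degree V E = Max (vertex_degree E ` V)"

(* A pair (u, w) stands for an arc from u to w; the disequality of truth values says that
   each edge receives exactly one of its two directions. *)
definition orientation :: "'a set set \<Rightarrow> ('a \<times> 'a) set \<Rightarrow> bool" where
  "orientation E A \<longleftrightarrow>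
     (\<forall>(u, w)\<in>A. {u, w} \<in> E) \<and>
     (\<forall>u w. {u, w} \<in> E \<longrightarrow> ((u, w) \<in> A) \<noteq> ((w, u) \<in> A))"

(* The list vs enumerates the vertices without repetition; indices start at 0. *)
definition skew_adjacency_matrix :: "'a list \<Rightarrow> ('a \<times> 'a) set \<Rightarrow> real mat" where
  "skew_adjacency_matrix vs A = mat (length vs) (length vs)
     (\<lambda>(i, j). if (vs ! i, vs ! j) \<in> A then 1 else if (vs ! j, vs ! i) \<in> A then - 1 else 0)"

end

(* Orthogonality of the k-th column to the others and skew-symmetry give S (S e_k) = - d e_k
   with d = |S_k|^2. So the span of e_k and S e_k is S-invariant, and S e_k + i sqrt(d) e_k is
   an eigenvector for i sqrt(d) if d > 0, while e_k lies in the kernel if d = 0. The entries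
   of S are 0, 1, -1, with a nonzero one exactly at each adjacency, so d is the degree of v_k. *)
theory Submission imports Defs begin

lemma skew_symmetric_orthogonal_column_eigenvalue:
  fixes S :: "real mat"
  assumes S: "S \<in> carrier_mat n n"
    and skew: "\<And>i j. i < n \<Longrightarrow> j < n \<Longrightarrow> S $$ (i, j) = - S $$ (j, i)"
    and k: "k < n"
    and orth: "\<And>j. j < n \<Longrightarrow> j \<noteq> k \<Longrightarrow> col S k \<bullet> col S j = 0"
  shows "eigenvalue (map_mat complex_of_real S)
           (\<i> * complex_of_real (sqrt (col S k \<bullet> col S k)))"
proof -
  define d where "d = col S k \<bullet> col S k"
  define c where "c = \<i> * complex_of_real (sqrt d)"
  have inner: "col S k \<bullet> col S j = (\<Sum>i<n. S $$ (i, k) * S $$ (i, j))" if "j < n" for j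
    using S k that by (simp add: scalar_prod_def atLeast0LessThan)
  have d: "d = (\<Sum>i<n. (S $$ (i, k))\<^sup>2)"
    using inner[OF k] by (simp add: d_def power2_eq_square)
  then have d_nonneg: "d \<ge> 0" by (simp add: sum_nonneg)
  \<comment> \<open>Regrouping brings the two real roots together; \<open>d_nonneg\<close> then lets
    \<open>sqrt d * sqrt d\<close> collapse to \<open>d\<close>.\<close>
  have "c * c = (\<i> * \<i>) * complex_of_real (sqrt d * sqrt d)"
    unfolding c_def of_real_mult by (simp only: ac_simps)
  then have c_sq: "c * c = - complex_of_real d"
    using d_nonneg by simp
  have diag: "S $$ (k, k) = 0" using skew[OF k k] by linarith
  \<comment> \<open>Entrywise form of S (S e_k) = -d e_k: by skew-symmetry, row \<open>i\<close> of
    S is the negative of column \<open>i\<close>, so the sum is minus an inner product of columns,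
    which orthogonality kills unless \<open>i = k\<close>.\<close>
  have sq: "(\<Sum>j<n. S $$ (i, j) * S $$ (j, k)) = (if i = k then - d else 0)" if i: "i < n" for i
  proof -
    have "(\<Sum>j<n. S $$ (i, j) * S $$ (j, k)) = - (col S k \<bullet> col S i)"
      unfolding inner[OF i] sum_negf[symmetric]
      by (rule sum.cong[OF refl], subst skew[OF i]) simp_all
    then show ?thesis using orth[OF i] by (auto simp: d_def)
  qed
  \<comment> \<open>The vector S e_k + c e_k is zero when \<open>d = 0\<close>, since then both
    \<open>c\<close> and column \<open>k\<close> vanish; hence the separate choice e_k.\<close>
  define x where "x = (if d = 0 then unit_vec n k
    else vec n (\<lambda>i. complex_of_real (S $$ (i, k)) + (if i = k then c else 0)))"
  have x: "x \<in> carrier_vec n" by (simp add: x_def)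
  \<comment> \<open>Because S has zero diagonal, coordinate \<open>k\<close> of \<open>x\<close> is
    1 if \<open>d = 0\<close> and \<open>c\<close> otherwise.\<close>
  have "x $ k \<noteq> 0" using k d_nonneg by (simp add: x_def diag c_def)
  then have x_nz: "x \<noteq> 0\<^sub>v n" using k by auto
  have "map_mat complex_of_real S *\<^sub>v x = c \<cdot>\<^sub>v x"
  proof (rule eq_vecI)
    show "dim_vec (map_mat complex_of_real S *\<^sub>v x) = dim_vec (c \<cdot>\<^sub>v x)"
      using S x by simp
    fix i assume "i < dim_vec (c \<cdot>\<^sub>v x)"
    then have i: "i < n" using x by simp
    have lhs: "(map_mat complex_of_real S *\<^sub>v x) $ i
        = (\<Sum>j<n. complex_of_real (S $$ (i, j)) * x $ j)"
      using S x i by (simp add: scalar_prod_def atLeast0LessThan)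
    show "(map_mat complex_of_real S *\<^sub>v x) $ i = (c \<cdot>\<^sub>v x) $ i"
    proof (cases "d = 0")
      case True
      \<comment> \<open>A vanishing sum of squares forces every entry of column \<open>k\<close> to
        be 0.\<close>
      then have "S $$ (i, k) = 0" using d i by (simp add: sum_nonneg_eq_0_iff)
      moreover have "(\<Sum>j<n. complex_of_real (S $$ (i, j)) * x $ j)
          = (\<Sum>j<n. if j = k then complex_of_real (S $$ (i, k)) else 0)"
        by (rule sum.cong) (use True k in \<open>auto simp: x_def\<close>)
      ultimately show ?thesis using True x i lhs by (simp add: c_def)
    next
      case False
      \<comment> \<open>Splits S x into S (S e_k) and c times S e_k; \<open>sq\<close> evaluates the
        first part.\<close>
      have "(\<Sum>j<n. complex_of_real (S $$ (i, j)) * x $ j)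
          = (\<Sum>j<n. complex_of_real (S $$ (i, j) * S $$ (j, k))
              + (if j = k then c * complex_of_real (S $$ (i, k)) else 0))"
        by (rule sum.cong) (use False in \<open>auto simp: x_def algebra_simps\<close>)
      also have "\<dots> = complex_of_real (if i = k then - d else 0)
          + c * complex_of_real (S $$ (i, k))"
        using k sq[OF i] by (simp add: sum.distrib flip: of_real_sum of_real_mult)
      \<comment> \<open>By \<open>c_sq\<close>, the entry -d at \<open>i = k\<close> is c * c, which
        is c times the contribution of c e_k to \<open>x\<close>.\<close>
      also have "\<dots> = c * x $ i"
        using False i c_sq by (simp add: x_def algebra_simps)
      finally show ?thesis using lhs x i by simp
    qed
  qed
  then have "eigenvector (map_mat complex_of_real S) x c"
    using S x x_nz by (simp add: eigenvector_def)
  then show ?thesis unfolding eigenvalue_def c_def d_def by blast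
qed

text \<open>An arc lies over an edge, and an edge carries just one direction. The case
  \<open>u = w\<close> excludes loops, so the matrix has zero diagonal.\<close>

lemma orientation_exclusive:
  assumes "orientation E A" "(u, w) \<in> A"
  shows "(w, u) \<notin> A"
proof -
  have "{u, w} \<in> E" using assms unfolding orientation_def by blast
  then show ?thesis using assms unfolding orientation_def by metis
qed

lemma orientation_edge_iff:
  assumes "orientation E A"
  shows "{u, w} \<in> E \<longleftrightarrow> (u, w) \<in> A \<or> (w, u) \<in> A"
proof
  show "(u, w) \<in> A \<or> (w, u) \<in> A" if "{u, w} \<in> E"
    using assms that unfolding orientation_def by metis
  have "{a, b} \<in> E" if "(a, b) \<in> A" for a b
    using assms that unfolding orientation_def by blast
  then show "{u, w} \<in> E" if "(u, w) \<in> A \<or> (w, u) \<in> A"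
    using that insert_commute[of u w] by metis
qed

text \<open>The matrix tests for the arc from row to column first, so opposite arcs would produce 1
  in both places; exclusivity of directions prevents this.\<close>

lemma skew_adjacency_matrix_skew:
  assumes "orientation E A" "i < length vs" "j < length vs"
  shows "skew_adjacency_matrix vs A $$ (i, j) = - skew_adjacency_matrix vs A $$ (j, i)"
  using assms(2,3) orientation_exclusive[OF assms(1), of "vs ! i" "vs ! j"]
  by (simp add: skew_adjacency_matrix_def)

lemma skew_adjacency_matrix_entry_sq:
  assumes "orientation E A" "i < length vs" "j < length vs"
  shows "(skew_adjacency_matrix vs A $$ (i, j))\<^sup>2 = (if {vs ! i, vs ! j} \<in> E then 1 else 0)"
  using assms(2,3)
  by (simp add: skew_adjacency_matrix_def orientation_edge_iff[OF assms(1)])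

text \<open>Sending a neighbour's index to the edge joining it to \<open>vs ! k\<close> is a
  bijection onto the incident edges. This turns the degree into a count over matrix rows.\<close>

lemma vertex_degree_eq_card_neighbours:
  assumes "simple_graph V E" "distinct vs" "set vs = V" "k < length vs"
  shows "vertex_degree E (vs ! k) = card {i. i < length vs \<and> {vs ! i, vs ! k} \<in> E}"
proof -
  let ?N = "{i. i < length vs \<and> {vs ! i, vs ! k} \<in> E}"
  have "inj_on (\<lambda>i. {vs ! i, vs ! k}) ?N"
    using assms(2) by (auto simp: inj_on_def doubleton_eq_iff nth_eq_iff_index_eq)
  moreover have "{e \<in> E. vs ! k \<in> e} = (\<lambda>i. {vs ! i, vs ! k}) ` ?N"
  proof (intro equalityI subsetI)
    fix e assume "e \<in> {e \<in> E. vs ! k \<in> e}"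
    then have e: "e \<in> E" "vs ! k \<in> e" "e \<subseteq> V" "card e = 2"
      using assms(1) by (auto simp: simple_graph_def)
    \<comment> \<open>A two-element edge through \<open>vs ! k\<close> has exactly one other
      endpoint.\<close>
    then obtain w where w: "e = {w, vs ! k}"
      by (auto simp: card_2_iff)
    then obtain i where "i < length vs" "vs ! i = w"
      using e assms(3) by (auto simp: in_set_conv_nth)
    then show "e \<in> (\<lambda>i. {vs ! i, vs ! k}) ` ?N" using e w by auto
  qed auto
  ultimately show ?thesis by (simp add: vertex_degree_def card_image)
qed

lemma skew_adjacency_matrix_col_norm:
  assumes "simple_graph V E" "distinct vs" "set vs = V" "orientation E A" "k < length vs"
  shows "col (skew_adjacency_matrix vs A) k \<bullet> col (skew_adjacency_matrix vs A) k
           = real (vertex_degree E (vs ! k))"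
proof -
  let ?S = "skew_adjacency_matrix vs A"
  have dims: "dim_row ?S = length vs" "dim_col ?S = length vs"
    by (simp_all add: skew_adjacency_matrix_def)
  have "col ?S k \<bullet> col ?S k = (\<Sum>i<length vs. (?S $$ (i, k))\<^sup>2)"
    using assms(5) by (simp add: scalar_prod_def dims power2_eq_square atLeast0LessThan)
  also have "\<dots> = (\<Sum>i<length vs. if {vs ! i, vs ! k} \<in> E then 1 else 0)"
    by (rule sum.cong) (simp_all add: skew_adjacency_matrix_entry_sq[OF assms(4)] assms(5))
  also have "\<dots> = real (card {i. i < length vs \<and> {vs ! i, vs ! k} \<in> E})"
    by (simp add: sum.If_cases Int_def)
  finally show ?thesis
    using vertex_degree_eq_card_neighbours[OF assms(1,2,3,5)] by simp
qed

theorem theorem3p4: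
  fixes V :: "'a set" and E :: "'a set set" and vs :: "'a list" and n :: nat
    and A :: "('a \<times> 'a) set" and S :: "real mat" and \<Delta> :: nat
  assumes "simple_graph V E"
    and "distinct vs" and "set vs = V" and "length vs = n"
    and "\<Delta> = max_degree V E"
    and "orientation E A"
    and "S = skew_adjacency_matrix vs A"
    and "\<exists>k<n. vertex_degree E (vs ! k) = \<Delta> \<and>
           (\<forall>j<n. j \<noteq> k \<longrightarrow> col S k \<bullet> col S j = 0)"
  shows "eigenvalue (map_mat complex_of_real S) (\<i> * complex_of_real (sqrt (real \<Delta>)))"
proof -
  obtain k where k: "k < n" "vertex_degree E (vs ! k) = \<Delta>"
    and orth: "\<And>j. j < n \<Longrightarrow> j \<noteq> k \<Longrightarrow> col S k \<bullet> col S j = 0"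
    using assms(8) by blast
  have S: "S \<in> carrier_mat n n"
    using assms(4,7) by (simp add: skew_adjacency_matrix_def)
  have skew: "S $$ (i, j) = - S $$ (j, i)" if "i < n" "j < n" for i j
    unfolding assms(7) using skew_adjacency_matrix_skew[OF assms(6)] that assms(4) by blast
  \<comment> \<open>The squared norm of column \<open>k\<close> is the degree of
    \<open>vs ! k\<close>, which is \<Delta> by the choice of \<open>k\<close>; this identifies the
    eigenvalue.\<close>
  have "col S k \<bullet> col S k = real \<Delta>"
    using skew_adjacency_matrix_col_norm[OF assms(1,2,3,6)] k assms(4,7) by simp
  then show ?thesis
    using skew_symmetric_orthogonal_column_eigenvalue[OF S skew k(1) orth] by simp
qed

end
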